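(* Let $D>0$ be a non-square discriminant, $k\in2\mathbb{N}$, and $\tau,z\in\mathbb{H}$. Then $$\omega_{k+1,D}(\tau,z)=\Omega_{k+1,D}(\tau,\overline z).$$ Moreover, $\omega_{k+1,D}$ satisfies $$\omega_{k+1,D}(\tau+1,z+1)=\omega_{k+1,D}(\tau,z),\qquad \omega_{k+1,D}\left(-\frac1\tau,-\frac1z\right)=\tau^{2k+2}\,\omega_{k+1,D}(\tau,z),$$ $$\lim_{z\to i\infty}\omega_{k+1,D}(\tau,z)=\psi_{k+1,D}(\tau),\qquad \lim_{\tau\to i\infty}\omega_{k+1,D}(\tau,z)=0,\qquad \omega_{k+1,D}(\tau,\tau)=0,$$ and $\omega_{k+1,D}$ is holomorphic with respect to $\tau$ and with respect to $z$.
   Context: Here $\mathbb{N}=\{1,2,3,\dots\}$, $\mathbb{H}$ is the complex upper half-plane and $\mathbb{H}^-=-\mathbb{H}$ is the lower half-plane. A discriminant is an integer $\equiv 0,1\pmod 4$. $\mathcal{Q}_D$ is the set of integral binary quadratic forms $Q=[a,b,c]$, $Q(x,y)=ax^2+bxy+cy^2$ with $a,b,c\in\mathbb{Z}$ and $b^2-4ac=D$ (since $D$ is not a square, $a\neq0$ and $c\ne0$). $\operatorname{Log}$ is the principal branch of the complex logarithm. For $Q=[a,b,c]\in\mathcal{Q}_D$ put $\alpha_Q^{\pm}=\frac{-b\pm\sqrt D}{2a}\in\mathbb{R}$, $\operatorname{sgn}(Q)=\operatorname{sgn}(a)$, and for $w\in\mathbb{C}\setminus\mathbb{R}$ put $Q_w=\frac{1}{\operatorname{Im}(w)}\left(a|w|^2+b\operatorname{Re}(w)+c\right)$.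 For $\tau,z\in\mathbb{H}$, $w\in\mathbb{H}^-$ define (all series converge absolutely) $$\psi_{k+1,D}(\tau)=\sum_{Q\in\mathcal{Q}_D}\frac{\operatorname{Log}\left(\frac{\tau-\alpha_Q^-}{\tau-\alpha_Q^+}\right)}{Q(\tau,1)^{k+1}},\qquad \rho_{k+1,D}(\tau,w)=\sum_{Q\in\mathcal{Q}_D}\frac{\operatorname{Log}\left(\frac{w-\alpha_Q^-}{w-\alpha_Q^+}\right)}{Q(\tau,1)^{k+1}},$$ $$\varphi_{k+1,D}(\tau)=\frac12\sum_{Q\in\mathcal{Q}_D}\frac{\operatorname{sgn}(Q)}{Q(\tau,1)^{k+1}},\qquad \lambda_{k+1,D}(\tau,w)=2i\sum_{Q\in\mathcal{Q}_D}\frac{\arctan\left(\frac{Q_w}{\sqrt D}\right)}{Q(\tau,1)^{k+1}},$$ $$\Omega_{k+1,D}(\tau,w)=\psi_{k+1,D}(\tau)-\rho_{k+1,D}(\tau,w)+2\pi i\,\varphi_{k+1,D}(\tau)+\lambda_{k+1,D}(\tau,w),$$ $$\omega_{k+1,D}(\tau,z)=\psi_{k+1,D}(\tau)-\sum_{Q\in\mathcal{Q}_D}\frac{\operatorname{Log}\left(\frac{z-\alpha_Q^-}{z-\alpha_Q^+}\right)}{Q(\tau,1)^{k+1}}.$$ The limits $\tau\to i\infty$, $z\to i\infty$ mean $\operatorname{Im}(\tau)\to\infty$, $\operatorname{Im}(z)\to\infty$. *)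

theory Defs
  imports "HOL-Analysis.Analysis" "HOL-Library.Going_To_Filter"
begin

definition upper_half_plane :: "complex set" where
  "upper_half_plane = {z. Im z > 0}"

definition is_discriminant :: "int \<Rightarrow> bool" where
  "is_discriminant D \<longleftrightarrow> D mod 4 = 0 \<or> D mod 4 = 1"

text \<open>The triple \<open>(a, b, c)\<close> encodes the form \<open>[a, b, c]\<close>, that is, \<open>a x\<^sup>2 + b x y + c y\<^sup>2\<close>.\<close>

type_synonym bqf = "int \<times> int \<times> int"

fun form_disc :: "bqf \<Rightarrow> int" where
  "form_disc (a, b, c) = b\<^sup>2 - 4 * a * c"

definition forms :: "int \<Rightarrow> bqf set" where
  "forms D = {Q. form_disc Q = D}"

fun form_eval :: "bqf \<Rightarrow> complex \<Rightarrow> complex \<Rightarrow> complex" where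
  "form_eval (a, b, c) x y = of_int a * x\<^sup>2 + of_int b * x * y + of_int c * y\<^sup>2"

text \<open>
  The leading coefficient is nonzero for every form of non-square discriminant, so no division by
  zero occurs in the roots below for the forms of interest.
\<close>

fun root_plus :: "bqf \<Rightarrow> real" where
  "root_plus (a, b, c) = (- of_int b + sqrt (of_int (form_disc (a, b, c)))) / (2 * of_int a)"

fun root_minus :: "bqf \<Rightarrow> real" where
  "root_minus (a, b, c) = (- of_int b - sqrt (of_int (form_disc (a, b, c)))) / (2 * of_int a)"

fun form_sgn :: "bqf \<Rightarrow> int" where
  "form_sgn (a, b, c) = sgn a"

text \<open>The quantity \<open>Q\<^sub>w\<close>, meaningful for non-real \<open>w\<close>.\<close>

fun form_at :: "bqf \<Rightarrow> complex \<Rightarrow> real" where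
  "form_at (a, b, c) w = (of_int a * (cmod w)\<^sup>2 + of_int b * Re w + of_int c) / Im w"

definition form_Log :: "bqf \<Rightarrow> complex \<Rightarrow> complex" where
  "form_Log Q w = Ln ((w - of_real (root_minus Q)) / (w - of_real (root_plus Q)))"

text \<open>
  In the following functions \<open>n\<close> is the full subscript, i.e.\ \<open>n = k + 1\<close>. The sums are
  unconditional sums, which over the complex numbers is the same as absolutely convergent sums;
  \<open>t\<close> and \<open>z\<close> are meant to range over the upper half-plane and \<open>w\<close> over the lower one.
\<close>

definition psi :: "nat \<Rightarrow> int \<Rightarrow> complex \<Rightarrow> complex" where
  "psi n D t = (\<Sum>\<^sub>\<infinity>Q\<in>forms D. form_Log Q t / form_eval Q t 1 ^ n)"

definition rho :: "nat \<Rightarrow> int \<Rightarrow> complex \<Rightarrow> complex \<Rightarrow> complex" where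
  "rho n D t w = (\<Sum>\<^sub>\<infinity>Q\<in>forms D. form_Log Q w / form_eval Q t 1 ^ n)"

definition phi :: "nat \<Rightarrow> int \<Rightarrow> complex \<Rightarrow> complex" where
  "phi n D t = 1 / 2 * (\<Sum>\<^sub>\<infinity>Q\<in>forms D. of_int (form_sgn Q) / form_eval Q t 1 ^ n)"

definition lambda :: "nat \<Rightarrow> int \<Rightarrow> complex \<Rightarrow> complex \<Rightarrow> complex" where
  "lambda n D t w =
     2 * \<i> * (\<Sum>\<^sub>\<infinity>Q\<in>forms D. of_real (arctan (form_at Q w / sqrt (of_int D))) / form_eval Q t 1 ^ n)"

definition Omega :: "nat \<Rightarrow> int \<Rightarrow> complex \<Rightarrow> complex \<Rightarrow> complex" where
  "Omega n D t w = psi n D t - rho n D t w + 2 * of_real pi * \<i> * phi n D t + lambda n D t w"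

definition omega :: "nat \<Rightarrow> int \<Rightarrow> complex \<Rightarrow> complex \<Rightarrow> complex" where
  "omega n D t z = psi n D t - (\<Sum>\<^sub>\<infinity>Q\<in>forms D. form_Log Q z / form_eval Q t 1 ^ n)"

end

theory Submission
  imports Defs "HOL-Complex_Analysis.Complex_Analysis"
begin

text \<open>
  On the upper half-plane the logarithm splits as \<open>Ln (z - \<alpha>\<^sup>-) - Ln (z - \<alpha>\<^sup>+)\<close>, so it is bounded by
  \<open>sqrt D / Im z\<close> uniformly in \<open>Q\<close> and has derivative \<open>- sqrt D / Q(z, 1)\<close>. Since \<open>|Q(t, 1)|\<close>
  dominates both \<open>|a| (Im t)\<^sup>2\<close> and \<open>Im t |2 a Re t + b|\<close>, it dominates \<open>|a| + |b|\<close>, locally uniformly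
  in \<open>t\<close>; as \<open>(a, b)\<close> determines \<open>Q\<close>, all series converge by comparison with
  \<open>\<Sum> (|a| + |b|) powr - n\<close>, \<open>n \<ge> 3\<close>. This gives holomorphy and both limits. The modular
  transformations permute the forms, and the identity with \<open>Omega\<close> holds term by term because
  \<open>(z - \<alpha>\<^sup>-) / (z - \<alpha>\<^sup>+)\<close> is a real multiple, with the sign of \<open>a\<close>, of \<open>Q\<^sub>z - \<i> sqrt D\<close>.
\<close>

section \<open>Series of holomorphic functions, sums over the integers, principal logarithms\<close>

text \<open>Weierstrass M-test: the majorant \<open>M\<close>, which may depend on the centre
  \<open>z\<close>, makes the finite partial sums converge uniformly on a closed disc, and uniform
  limits of holomorphic functions are holomorphic inside it.\<close>

lemma holomorphic_on_infsum:
  fixes f :: "'a \<Rightarrow> complex \<Rightarrow> complex"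
  assumes "open S"
    and hol: "\<And>x. x \<in> A \<Longrightarrow> f x holomorphic_on S"
    and bound: "\<And>z. z \<in> S \<Longrightarrow>
      \<exists>r>0. \<exists>M. M summable_on A \<and> cball z r \<subseteq> S \<and> (\<forall>x\<in>A. \<forall>y\<in>cball z r. norm (f x y) \<le> M x)"
  shows "(\<lambda>z. \<Sum>\<^sub>\<infinity>x\<in>A. f x z) holomorphic_on S"
  unfolding holomorphic_on_open[OF \<open>open S\<close>]
proof
  fix z assume "z \<in> S"
  then obtain r M where r: "r > 0" "cball z r \<subseteq> S" and M: "M summable_on A"
    "\<And>x y. x \<in> A \<Longrightarrow> y \<in> cball z r \<Longrightarrow> norm (f x y) \<le> M x"
    using bound by meson
  have lim: "uniform_limit (cball z r) (\<lambda>X y. \<Sum>x\<in>X. f x y) (\<lambda>y. \<Sum>\<^sub>\<infinity>x\<in>A. f x y)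
      (finite_subsets_at_top A)"
    using M by (intro Weierstrass_m_test_general) auto
  have "(\<lambda>y. \<Sum>x\<in>X. f x y) holomorphic_on S" if "X \<subseteq> A" for X
    using hol that by (intro holomorphic_on_sum) auto
  then have "continuous_on (cball z r) (\<lambda>y. \<Sum>x\<in>X. f x y) \<and>
      (\<lambda>y. \<Sum>x\<in>X. f x y) holomorphic_on ball z r" if "X \<subseteq> A" for X
    using that r(2) ball_subset_cball
    by (meson holomorphic_on_imp_continuous_on holomorphic_on_subset order_trans)
  then have "\<forall>\<^sub>F X in finite_subsets_at_top A. continuous_on (cball z r) (\<lambda>y. \<Sum>x\<in>X. f x y) \<and>
      (\<lambda>y. \<Sum>x\<in>X. f x y) holomorphic_on ball z r"
    by (intro eventually_finite_subsets_at_top_weakI) auto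
  then have "(\<lambda>y. \<Sum>\<^sub>\<infinity>x\<in>A. f x y) holomorphic_on ball z r"
    using lim by (rule holomorphic_uniform_limit) auto
  then show "\<exists>d. ((\<lambda>y. \<Sum>\<^sub>\<infinity>x\<in>A. f x y) has_field_derivative d) (at z)"
    using r(1) by (metis centre_in_ball holomorphic_on_open open_ball)
qed

text \<open>The integers are covered by the images of \<open>int\<close> and its negative; on each
  the sum is a shifted p-series.\<close>

lemma summable_on_int_powr:
  fixes s :: real
  assumes "s > 1"
  shows "(\<lambda>m::int. (1 + \<bar>real_of_int m\<bar>) powr - s) summable_on UNIV"
proof -
  have "summable (\<lambda>n. real (n + 1) powr - s)"
    using summable_real_powr_iff[of "- s"] summable_iff_shift[of "\<lambda>n. real n powr - s" 1] assms
    by simp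
  then have nat: "(\<lambda>n. (1 + real n) powr - s) summable_on (UNIV :: nat set)"
    by (subst summable_on_UNIV_nonneg_real_iff) (auto simp: add.commute)
  have "(\<lambda>m::int. (1 + \<bar>real_of_int m\<bar>) powr - s) summable_on range int"
    by (subst summable_on_reindex) (use nat in \<open>auto simp: o_def inj_on_def\<close>)
  moreover have "(\<lambda>m::int. (1 + \<bar>real_of_int m\<bar>) powr - s) summable_on range (\<lambda>n. - int n)"
    by (subst summable_on_reindex) (use nat in \<open>auto simp: o_def inj_on_def\<close>)
  ultimately have "(\<lambda>m::int. (1 + \<bar>real_of_int m\<bar>) powr - s) summable_on
      (range int \<union> range (\<lambda>n. - int n))"
    by (rule summable_on_union)
  also have "range int \<union> range (\<lambda>n. - int n) = UNIV"
    by (auto simp: image_iff) (metis int_cases2)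
  finally show ?thesis .
qed

text \<open>Real shifts keep both points in the upper half-plane, so both logarithms have imaginary
  part in (0, pi) and their difference stays inside the principal strip.\<close>

lemma Ln_divide_shift_real:
  assumes "Im z > 0"
  shows "Ln ((z - of_real p) / (z - of_real q)) = Ln (z - of_real p) - Ln (z - of_real q)"
proof (rule Ln_unique)
  have ne: "z - of_real p \<noteq> 0" "z - of_real q \<noteq> 0"
    using assms by auto
  then show "exp (Ln (z - of_real p) - Ln (z - of_real q)) = (z - of_real p) / (z - of_real q)"
    by (simp add: exp_diff)
  have "0 < Im (Ln (z - of_real x)) \<and> Im (Ln (z - of_real x)) < pi" for x
    using Im_Ln_pos_lt_imp[of "z - of_real x"] assms by simp
  from this[of p] this[of q]
  show "- pi < Im (Ln (z - of_real p) - Ln (z - of_real q))"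
    "Im (Ln (z - of_real p) - Ln (z - of_real q)) \<le> pi"
    by auto
qed

text \<open>Mean value inequality on the convex set \<open>Im w >= y\<close>, where the derivative
  1/w has modulus at most 1/y.\<close>

lemma norm_Ln_diff_le:
  assumes "y > 0" "Im u \<ge> y" "Im v \<ge> y"
  shows "norm (Ln u - Ln v) \<le> norm (u - v) / y"
proof -
  have "norm (Ln u - Ln v) \<le> (1 / y) * norm (u - v)"
  proof (rule field_differentiable_bound[where S = "{w. Im w \<ge> y}" and f' = inverse])
    show "convex {w. Im w \<ge> y}"
      by (rule convex_halfspace_Im_ge)
    fix w assume w: "w \<in> {w. Im w \<ge> y}"
    then have "w \<notin> \<real>\<^sub>\<le>\<^sub>0"
      using assms(1) by (auto simp: complex_nonpos_Reals_iff)
    then show "(Ln has_field_derivative inverse w) (at w within {w. Im w \<ge> y})"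
      by (rule has_field_derivative_Ln[THEN has_field_derivative_at_within])
    have "y \<le> norm w"
      using w abs_Im_le_cmod[of w] by auto
    then have "1 / norm w \<le> 1 / y"
      using assms(1) by (intro frac_le) auto
    then show "norm (inverse w) \<le> 1 / y"
      by (metis norm_inverse inverse_eq_divide)
  qed (use assms in auto)
  then show ?thesis
    by (simp add: mult.commute)
qed

section \<open>Coefficients and roots of forms of non-square discriminant\<close>

locale nonsquare_discriminant =
  fixes D :: int
  assumes D_pos: "D > 0" and nonsquare: "\<nexists>m. D = m\<^sup>2"
begin

declare form_eval.simps [simp del] root_plus.simps [simp del] root_minus.simps [simp del]

text \<open>If a or c vanished, D would be the square of b.\<close>

lemma form_coeff_nonzero:
  assumes "(a, b, c) \<in> forms D"
  shows "a \<noteq> 0" "c \<noteq> 0"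
  using assms nonsquare by (auto simp: forms_def)

text \<open>Stated with projections so that it also rewrites roots of transformed forms, all
  expressed through the same \<open>sqrt D\<close>.\<close>

lemma root_plus_eq:
  "Q \<in> forms D \<Longrightarrow> root_plus Q = (- of_int (fst (snd Q)) + sqrt (of_int D)) / (2 * of_int (fst Q))"
  by (cases Q) (auto simp: forms_def root_plus.simps root_minus.simps)

lemma root_minus_eq:
  "Q \<in> forms D \<Longrightarrow> root_minus Q = (- of_int (fst (snd Q)) - sqrt (of_int D)) / (2 * of_int (fst Q))"
  by (cases Q) (auto simp: forms_def root_plus.simps root_minus.simps)

lemma sqrt_D_pos: "sqrt (of_int D) > 0"
  using D_pos by simp

text \<open>For negative a, \<open>root_plus\<close> is the smaller root, so the difference carries
  the sign of a.\<close>

lemma root_diff: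
  assumes "(a, b, c) \<in> forms D"
  shows "root_plus (a, b, c) - root_minus (a, b, c) = sqrt (of_int D) / of_int a"
  using form_coeff_nonzero[OF assms]
  by (simp add: root_plus_eq[OF assms] root_minus_eq[OF assms] field_simps)

lemma root_sum:
  assumes "(a, b, c) \<in> forms D"
  shows "root_plus (a, b, c) + root_minus (a, b, c) = - of_int b / of_int a"
  using form_coeff_nonzero[OF assms]
  by (simp add: root_plus_eq[OF assms] root_minus_eq[OF assms] field_simps)

lemma root_prod:
  assumes "(a, b, c) \<in> forms D"
  shows "root_plus (a, b, c) * root_minus (a, b, c) = of_int c / of_int a"
proof -
  define s where "s = sqrt (of_int D)"
  have "s\<^sup>2 = of_int D"
    unfolding s_def using D_pos by simp
  also have "D = b\<^sup>2 - 4 * a * c"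
    using assms by (simp add: forms_def)
  finally have s: "s * s = (of_int b)\<^sup>2 - 4 * of_int a * of_int c"
    by (simp add: power2_eq_square)
  have "(- of_int b + s) * (- of_int b - s) = 4 * of_int a * (of_int c :: real)"
    using s by (simp add: algebra_simps power2_eq_square)
  then show ?thesis
    using form_coeff_nonzero[OF assms]
    by (simp add: root_plus_eq[OF assms] root_minus_eq[OF assms] flip: s_def)
qed

lemma form_eval_factor:
  assumes "(a, b, c) \<in> forms D"
  shows "form_eval (a, b, c) t 1 =
    of_int a * (t - of_real (root_plus (a, b, c))) * (t - of_real (root_minus (a, b, c)))"
proof -
  define p q where "p = root_plus (a, b, c)" and "q = root_minus (a, b, c)"
  have "complex_of_real p + of_real q = - of_int b / of_int a"
    using arg_cong[OF root_sum[OF assms], of complex_of_real] by (simp add: p_def q_def)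
  then have b: "of_int b = - of_int a * (complex_of_real p + of_real q)"
    using form_coeff_nonzero[OF assms] by (simp add: field_simps)
  have "complex_of_real p * of_real q = of_int c / of_int a"
    using arg_cong[OF root_prod[OF assms], of complex_of_real] by (simp add: p_def q_def)
  then have c: "of_int c = of_int a * (complex_of_real p * of_real q)"
    using form_coeff_nonzero[OF assms] by (simp add: field_simps)
  show ?thesis
    unfolding p_def[symmetric] q_def[symmetric] form_eval.simps b c
    by (simp add: algebra_simps power2_eq_square)
qed

section \<open>Lower bounds for forms and absolute convergence\<close>

text \<open>The roots are real, so each linear factor has modulus at least the modulus of
  \<open>Im t\<close>.\<close>

lemma norm_form_eval_ge_lead:
  assumes "(a, b, c) \<in> forms D"
  shows "\<bar>of_int a\<bar> * (Im t)\<^sup>2 \<le> norm (form_eval (a, b, c) t 1)"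
proof -
  have "\<bar>Im t\<bar> \<le> norm (t - of_real x)" for x
    using abs_Im_le_cmod[of "t - of_real x"] by simp
  then have "\<bar>Im t\<bar> * \<bar>Im t\<bar> \<le>
      norm (t - of_real (root_plus (a, b, c))) * norm (t - of_real (root_minus (a, b, c)))"
    by (intro mult_mono) auto
  then have "\<bar>of_int a\<bar> * (\<bar>Im t\<bar> * \<bar>Im t\<bar>) \<le> \<bar>of_int a\<bar> *
      (norm (t - of_real (root_plus (a, b, c))) * norm (t - of_real (root_minus (a, b, c))))"
    by (rule mult_left_mono) auto
  then show ?thesis
    by (simp add: form_eval_factor[OF assms] norm_mult power2_eq_square mult.assoc)
qed

lemma norm_form_eval_pos:
  assumes "Q \<in> forms D" "Im t > 0"
  shows "norm (form_eval Q t 1) > 0"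
proof -
  obtain a b c where Q: "Q = (a, b, c)"
    by (cases Q)
  have "0 < \<bar>of_int a\<bar> * (Im t)\<^sup>2"
    using form_coeff_nonzero assms Q by simp
  with norm_form_eval_ge_lead[of a b c t] assms show ?thesis
    unfolding Q by linarith
qed

text \<open>The coefficient c is left out because c = (b^2 - D) / (4 a): a form is determined by a,
  b and D.\<close>

fun form_size :: "bqf \<Rightarrow> real" where
  "form_size (a, b, c) = \<bar>of_int a\<bar> + \<bar>of_int b\<bar>"

lemma form_size_ge_1: "Q \<in> forms D \<Longrightarrow> form_size Q \<ge> 1"
  using form_coeff_nonzero by (cases Q) fastforce

text \<open>With N the modulus of Q(t, 1), the leading-coefficient bound gives |a| <= N / y^2. The
  imaginary part of Q(t, 1) is \<open>Im t\<close> times 2 a Re t + b, which bounds b by N / y + 2 X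
  N / y^2. The constant is the sum of both and depends on t only through \<open>y\<close> and
  \<open>X\<close>.\<close>

lemma form_size_le:
  assumes Q: "Q \<in> forms D" and t: "Im t \<ge> y" "y > 0" and X: "\<bar>Re t\<bar> \<le> X"
  shows "form_size Q \<le> (1 / y + (1 + 2 * X) / y\<^sup>2) * norm (form_eval Q t 1)"
proof -
  obtain a b c where [simp]: "Q = (a, b, c)"
    by (cases Q)
  define N where "N = norm (form_eval Q t 1)"
  have "\<bar>of_int a\<bar> * y\<^sup>2 \<le> \<bar>of_int a\<bar> * (Im t)\<^sup>2"
    using t by (intro mult_left_mono power_mono) auto
  also have "\<dots> \<le> N"
    using norm_form_eval_ge_lead[of a b c t] Q by (simp add: N_def)
  finally have a: "\<bar>of_int a\<bar> \<le> N / y\<^sup>2"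
    using t by (simp add: field_simps)
  have "Im (form_eval Q t 1) = Im t * (2 * of_int a * Re t + of_int b)"
    by (simp add: form_eval.simps power2_eq_square algebra_simps)
  then have "Im t * \<bar>2 * of_int a * Re t + of_int b\<bar> \<le> N"
    using abs_Im_le_cmod[of "form_eval Q t 1"] t unfolding N_def by (simp add: abs_mult)
  moreover have "y * \<bar>2 * of_int a * Re t + of_int b\<bar> \<le> Im t * \<bar>2 * of_int a * Re t + of_int b\<bar>"
    using t by (intro mult_right_mono) auto
  ultimately have b: "\<bar>2 * of_int a * Re t + of_int b\<bar> \<le> N / y"
    using t by (simp add: field_simps)
  have "\<bar>of_int b\<bar> \<le> \<bar>2 * of_int a * Re t + of_int b\<bar> + \<bar>2 * of_int a * Re t\<bar>"
    by linarith
  also have "\<dots> = \<bar>2 * of_int a * Re t + of_int b\<bar> + 2 * (\<bar>of_int a\<bar> * \<bar>Re t\<bar>)"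
    by (simp add: abs_mult)
  also have "\<dots> \<le> N / y + 2 * (N / y\<^sup>2 * X)"
    using a b X by (intro add_mono mult_left_mono mult_mono) auto
  finally show ?thesis
    using a by (simp add: N_def algebra_simps add_divide_distrib)
qed

text \<open>Comparison with a product: the exponent 3 is split evenly, leaving 3/2 > 1 for each of a
  and b, so the double sum factors into two convergent sums over the integers.\<close>

lemma summable_form_size:
  assumes "n \<ge> 3"
  shows "(\<lambda>Q. 1 / form_size Q ^ n) summable_on forms D"
proof -
  define g :: "int \<Rightarrow> real" where "g m = (1 + \<bar>of_int m\<bar>) powr - (3/2)" for m
  have g: "g summable_on UNIV"
    unfolding g_def by (rule summable_on_int_powr) simp
  have "(\<lambda>(a, b). 2 powr (3/2) * (g a * g b)) summable_on (UNIV \<times> UNIV)"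
  proof (rule summable_on_SigmaI)
    fix a :: int
    show "((\<lambda>b. case (a, b) of (a, b) \<Rightarrow> 2 powr (3/2) * (g a * g b)) has_sum
        2 powr (3/2) * (g a * infsum g UNIV)) UNIV"
      using g by (auto intro!: has_sum_cmult_right)
    show "0 \<le> (case (a, b) of (a, b) \<Rightarrow> 2 powr (3/2) * (g a * g b))" for b
      by (simp add: g_def)
  next
    show "(\<lambda>a. 2 powr (3/2) * (g a * infsum g UNIV)) summable_on UNIV"
      using g by (intro summable_on_cmult_right summable_on_cmult_left)
  qed
  \<comment> \<open>The sum over all integer pairs restricts to the pairs (a, b) of forms and is
    then pulled back along the injective projection.\<close>
  then have "(\<lambda>(a, b). 2 powr (3/2) * (g a * g b)) summable_on (\<lambda>(a, b, c). (a, b)) ` forms D"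
    by (rule summable_on_subset_banach) auto
  moreover have "inj_on (\<lambda>(a, b, c). (a, b)) (forms D)"
    using form_coeff_nonzero by (fastforce simp: inj_on_def forms_def)
  ultimately have "(\<lambda>(a, b, c). 2 powr (3/2) * (g a * g b)) summable_on forms D"
    by (subst (asm) summable_on_reindex) (auto simp: o_def case_prod_unfold)
  then show ?thesis
  proof (rule summable_on_comparison_test)
    fix Q assume Q: "Q \<in> forms D"
    obtain a b c where [simp]: "Q = (a, b, c)"
      by (cases Q)
    define N where "N = form_size Q"
    have a: "1 \<le> \<bar>real_of_int a\<bar>"
      using form_coeff_nonzero[of a b c] Q by simp
    have N: "N \<ge> 1"
      using form_size_ge_1[OF Q] by (simp add: N_def)
    \<comment> \<open>As |a| >= 1, the first factor is at most 2 |a| <= 2 N and the second at most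
      |a| + |b| = N.\<close>
    have "(1 + \<bar>of_int a\<bar>) * (1 + \<bar>of_int b\<bar>) \<le> (2 * N) * N"
      using a by (intro mult_mono) (auto simp: N_def)
    then have "((1 + \<bar>of_int a\<bar>) * (1 + \<bar>of_int b\<bar>)) powr (3/2) \<le> (2 * N\<^sup>2) powr (3/2)"
      by (intro powr_mono2) (auto simp: power2_eq_square mult.assoc)
    also have "\<dots> = 2 powr (3/2) * N ^ 3"
      using N by (simp add: powr_mult powr_powr flip: powr_numeral)
    finally have *: "((1 + \<bar>of_int a\<bar>) * (1 + \<bar>of_int b\<bar>)) powr (3/2) \<le> 2 powr (3/2) * N ^ 3" .
    have "1 / N ^ n \<le> 1 / N ^ 3"
      using N assms by (intro divide_left_mono power_increasing) auto
    also have "\<dots> \<le> 2 powr (3/2) / ((1 + \<bar>of_int a\<bar>) * (1 + \<bar>of_int b\<bar>)) powr (3/2)"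
    proof -
      have "((1 + \<bar>real_of_int a\<bar>) * (1 + \<bar>of_int b\<bar>)) powr (3/2) > 0"
        by (smt (verit) powr_gt_zero mult_pos_pos abs_ge_zero)
      with * N show ?thesis
        by (simp add: pos_le_divide_eq pos_divide_le_eq mult.commute)
    qed
    also have "\<dots> = 2 powr (3/2) / ((1 + \<bar>of_int a\<bar>) powr (3/2) * (1 + \<bar>of_int b\<bar>) powr (3/2))"
      by (subst powr_mult) auto
    also have "\<dots> = 2 powr (3/2) * (g a * g b)"
      by (simp add: g_def powr_minus field_simps)
    finally show "1 / form_size Q ^ n \<le> (case Q of (a, b, c) \<Rightarrow> 2 powr (3/2) * (g a * g b))"
      by (simp add: N_def)
    show "0 \<le> 1 / form_size Q ^ n"
      using N by (simp add: N_def)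
  qed
qed

lemma form_eval_power_bound:
  assumes "Q \<in> forms D" "Im t \<ge> y" "y > 0" "\<bar>Re t\<bar> \<le> X"
  shows "1 / norm (form_eval Q t 1) ^ n \<le> (1 / y + (1 + 2 * X) / y\<^sup>2) ^ n * (1 / form_size Q ^ n)"
proof -
  define C where "C = 1 / y + (1 + 2 * X) / y\<^sup>2"
  have "form_size Q ^ n \<le> (C * norm (form_eval Q t 1)) ^ n"
    using form_size_le[OF assms] form_size_ge_1[OF assms(1)] unfolding C_def
    by (intro power_mono) auto
  moreover have "form_size Q > 0" "norm (form_eval Q t 1) > 0"
    using form_size_ge_1[OF assms(1)] norm_form_eval_pos[OF assms(1)] assms(2,3) by fastforce+
  ultimately show ?thesis
    unfolding C_def[symmetric] by (simp add: field_simps power_mult_distrib)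
qed

text \<open>Common majorant of all the series: it carries the dependence on t, while the numerators
  contribute only a uniform bound.\<close>

definition abs_series :: "nat \<Rightarrow> complex \<Rightarrow> real" where
  "abs_series n t = (\<Sum>\<^sub>\<infinity>Q\<in>forms D. 1 / norm (form_eval Q t 1) ^ n)"

lemma summable_abs_series:
  assumes "n \<ge> 3" "Im t > 0"
  shows "(\<lambda>Q. 1 / norm (form_eval Q t 1) ^ n) summable_on forms D"
proof (rule summable_on_comparison_test)
  show "(\<lambda>Q. (1 / Im t + (1 + 2 * \<bar>Re t\<bar>) / (Im t)\<^sup>2) ^ n * (1 / form_size Q ^ n)) summable_on forms D"
    using summable_form_size[OF assms(1)] by (rule summable_on_cmult_right)
qed (use form_eval_power_bound[OF _ order_refl] assms in auto)

text \<open>Applied to logarithms, signs and arctangents alike, since each of these numerators is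
  bounded uniformly in the form.\<close>

lemma
  assumes "n \<ge> 3" "Im t > 0" and bound: "\<And>Q. Q \<in> forms D \<Longrightarrow> norm (f Q) \<le> B"
  shows summable_form_series: "(\<lambda>Q. f Q / form_eval Q t 1 ^ n) summable_on forms D"
    and norm_form_series_le: "norm (\<Sum>\<^sub>\<infinity>Q\<in>forms D. f Q / form_eval Q t 1 ^ n) \<le> B * abs_series n t"
proof -
  have summ: "(\<lambda>Q. B * (1 / norm (form_eval Q t 1) ^ n)) summable_on forms D"
    using summable_abs_series[OF assms(1,2)] by (rule summable_on_cmult_right)
  have le: "norm (f Q / form_eval Q t 1 ^ n) \<le> B * (1 / norm (form_eval Q t 1) ^ n)"
    if "Q \<in> forms D" for Q
    using bound[OF that] by (simp add: norm_divide norm_power divide_right_mono)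
  show 1: "(\<lambda>Q. f Q / form_eval Q t 1 ^ n) summable_on forms D"
    using Infinite_Sum.abs_summable_on_comparison_test'[OF summ le] by (rule abs_summable_summable)
  show "norm (\<Sum>\<^sub>\<infinity>Q\<in>forms D. f Q / form_eval Q t 1 ^ n) \<le> B * abs_series n t"
  proof (rule norm_infsum_le[OF has_sum_infsum[OF 1] _ le])
    show "((\<lambda>Q. B * (1 / norm (form_eval Q t 1) ^ n)) has_sum B * abs_series n t) (forms D)"
      unfolding abs_series_def using summable_abs_series[OF assms(1,2)]
      by (intro has_sum_cmult_right has_sum_infsum)
  qed
qed

section \<open>The logarithm attached to a form\<close>

lemma form_Log_eq:
  assumes "Im z > 0"
  shows "form_Log Q z = Ln (z - of_real (root_minus Q)) - Ln (z - of_real (root_plus Q))"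
  unfolding form_Log_def using assms by (rule Ln_divide_shift_real)

text \<open>Both shifted points have imaginary part \<open>Im z\<close>, and their distance is
  \<open>sqrt D\<close> / |a|, at most \<open>sqrt D\<close> because a is a nonzero integer.\<close>

lemma norm_form_Log_le:
  assumes "Q \<in> forms D" "Im z > 0"
  shows "norm (form_Log Q z) \<le> sqrt (of_int D) / Im z"
proof -
  obtain a b c where Q: "Q = (a, b, c)"
    by (cases Q)
  have "norm (form_Log Q z) \<le> norm (of_real (root_plus Q - root_minus Q) :: complex) / Im z"
    unfolding form_Log_eq[OF assms(2)]
    using norm_Ln_diff_le[of "Im z" "z - of_real (root_minus Q)" "z - of_real (root_plus Q)"] assms(2)
    by simp
  also have "\<dots> = sqrt (of_int D) / \<bar>of_int a\<bar> / Im z"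
    using root_diff[of a b c] assms(1) D_pos unfolding Q norm_of_real by (simp add: abs_divide)
  also have "\<dots> \<le> sqrt (of_int D) / Im z"
  proof (rule divide_right_mono)
    have "1 \<le> \<bar>real_of_int a\<bar>"
      using form_coeff_nonzero[of a b c] assms(1) Q by simp
    then show "sqrt (of_int D) / \<bar>of_int a\<bar> \<le> sqrt (of_int D)"
      using sqrt_D_pos by (simp add: divide_simps)
  qed (use assms in auto)
  finally show ?thesis .
qed

text \<open>Partial fractions: the root difference \<open>sqrt D\<close> / a cancels the leading
  coefficient, so the numerator is the same for all forms. This is what makes inversion work
  later.\<close>

lemma form_Log_deriv:
  assumes "Q \<in> forms D" "Im z > 0"
  shows "(form_Log Q has_field_derivative - of_real (sqrt (of_int D)) / form_eval Q z 1) (at z)"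
proof -
  obtain a b c where Q: "Q = (a, b, c)"
    by (cases Q)
  define p q where "p = root_plus Q" and "q = root_minus Q"
  have ne: "z - of_real p \<noteq> 0" "z - of_real q \<noteq> 0"
    using assms(2) by auto
  have "((\<lambda>z. Ln (z - of_real q) - Ln (z - of_real p)) has_field_derivative
      1 / (z - of_real q) - 1 / (z - of_real p)) (at z)"
    using assms(2) by (auto intro!: derivative_eq_intros simp: complex_nonpos_Reals_iff field_simps)
  also have "1 / (z - of_real q) - 1 / (z - of_real p) =
      - of_real (p - q) / ((z - of_real p) * (z - of_real q))"
    using ne by (simp add: field_simps)
  also have "p - q = sqrt (of_int D) / of_int a"
    unfolding p_def q_def Q using root_diff assms(1) Q by blast
  also have "- of_real (sqrt (of_int D) / of_int a) / ((z - of_real p) * (z - of_real q)) =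
      - of_real (sqrt (of_int D)) / form_eval Q z 1"
    using form_eval_factor[of a b c z] assms(1) by (simp add: p_def q_def Q mult.assoc)
  finally show ?thesis
  proof (rule has_field_derivative_transform_within_open)
    show "open {w. Im w > 0}"
      by (rule open_halfspace_Im_gt)
  qed (use assms(2) form_Log_eq in \<open>auto simp: p_def q_def\<close>)
qed

lemma form_Log_holomorphic:
  assumes "Q \<in> forms D"
  shows "form_Log Q holomorphic_on upper_half_plane"
  unfolding holomorphic_on_def upper_half_plane_def
  using form_Log_deriv[OF assms] field_differentiable_at_within field_differentiable_def by blast

text \<open>The quotient \<open>X\<close> is a real multiple of \<open>form_at Q z\<close> - i
  \<open>s\<close>. Multiplying by i times the sign of a turns it into the right half-plane, where
  the argument is an arctangent; turning back costs pi/2 times that sign.\<close>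

lemma Im_form_Log:
  assumes "Q \<in> forms D" "Im z > 0"
  shows "Im (form_Log Q z) = arctan (form_at Q z / sqrt (of_int D)) - pi / 2 * of_int (form_sgn Q)"
proof -
  obtain a b c where Q: "Q = (a, b, c)"
    by (cases Q)
  define p q where "p = root_plus Q" and "q = root_minus Q"
  define s where "s = sqrt (of_int D)"
  define \<theta> where "\<theta> = arctan (form_at Q z / s)"
  define X where "X = (z - of_real q) / (z - of_real p)"
  have s: "s > 0"
    using sqrt_D_pos by (simp add: s_def)
  have a: "of_int a \<noteq> (0::real)"
    using form_coeff_nonzero[of a b c] assms(1) Q by simp
  \<comment> \<open>The real factor left after multiplying the quotient through by the conjugate
    denominator; its sign is that of a.\<close>
  define r where "r = Im z / (of_int a * (norm (z - of_real p))\<^sup>2)"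
  have zp: "z - of_real p \<noteq> 0"
    using assms(2) by auto
  have pq: "p + q = - of_int b / of_int a" "p * q = of_int c / of_int a" "p - q = s / of_int a"
    unfolding p_def q_def Q s_def
    using root_sum[of a b c] root_prod[of a b c] root_diff[of a b c] assms(1) Q by auto
  have num: "(z - of_real q) * cnj (z - of_real p) = of_real (Im z / of_int a) * Complex (form_at Q z) (- s)"
  proof (rule complex_eqI)
    have "Re ((z - of_real q) * cnj (z - of_real p)) = (norm z)\<^sup>2 - (p + q) * Re z + p * q"
      by (simp add: cmod_power2) (simp add: algebra_simps power2_eq_square)
    also have "\<dots> = (Im z / of_int a) * form_at Q z"
      unfolding pq Q using a assms(2) by (simp add: field_simps)
    finally show "Re ((z - of_real q) * cnj (z - of_real p)) =
        Re (of_real (Im z / of_int a) * Complex (form_at Q z) (- s))"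
      by simp
    have "Im ((z - of_real q) * cnj (z - of_real p)) = - (p - q) * Im z"
      by (simp add: algebra_simps)
    then show "Im ((z - of_real q) * cnj (z - of_real p)) =
        Im (of_real (Im z / of_int a) * Complex (form_at Q z) (- s))"
      unfolding pq by simp
  qed
  have "X = (z - of_real q) * cnj (z - of_real p) / of_real ((norm (z - of_real p))\<^sup>2)"
    unfolding X_def by (rule complex_div_cnj)
  also have "\<dots> = of_real r * Complex (form_at Q z) (- s)"
    unfolding num r_def by (simp add: field_simps)
  finally have X: "X = of_real r * Complex (form_at Q z) (- s)" .
  have sgn_r: "sgn r = sgn (of_int a)"
    using zp assms(2) by (simp add: r_def sgn_mult sgn_divide)
  have "r \<noteq> 0"
    using sgn_r a by (metis sgn_0_0 of_int_0_eq_iff)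
  with s have "X \<noteq> 0"
    by (auto simp: X complex_eq_iff)
  have \<theta>: "- (pi / 2) < \<theta>" "\<theta> < pi / 2"
    unfolding \<theta>_def using arctan_bounded by auto
  define e where "e = sgn (real_of_int a)"
  have e: "e = 1 \<or> e = -1"
    using a by (auto simp: e_def sgn_if)
  have re: "Re (\<i> * of_real e * X) = \<bar>r\<bar> * s" "Im (\<i> * of_real e * X) = \<bar>r\<bar> * form_at Q z"
    using sgn_r by (simp_all add: X e_def abs_sgn mult_ac)
  then have "Im (\<i> * of_real e * X) / Re (\<i> * of_real e * X) = form_at Q z / s"
    "Re (\<i> * of_real e * X) > 0"
    using \<open>r \<noteq> 0\<close> s by simp_all
  then have "Arg (\<i> * of_real e * X) = \<theta>"
    unfolding \<theta>_def using arg_conv_arctan by metis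
  moreover have nz: "\<i> * of_real e * X \<noteq> 0"
    using e \<open>X \<noteq> 0\<close> by auto
  ultimately have Im: "Im (Ln (\<i> * of_real e * X)) = \<theta>"
    by (simp add: Arg_eq_Im_Ln)
  \<comment> \<open>Since the turned argument lies strictly between -pi/2 and pi/2, a shift by pi/2
    either way stays in the principal strip and no multiple of 2 pi appears.\<close>
  have "Ln X = Ln (\<i> * of_real e * X) - \<i> * of_real (pi / 2 * e)"
  proof (rule Ln_unique)
    have "exp (\<i> * of_real (pi / 2 * e)) = \<i> * of_real e"
      using e by (auto simp: exp_eq_polar cis.ctr complex_eq_iff Re_exp Im_exp)
    then show "exp (Ln (\<i> * of_real e * X) - \<i> * of_real (pi / 2 * e)) = X"
      using nz e unfolding exp_diff by auto
  qed (use Im \<theta> e in auto)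
  then have "Im (form_Log Q z) = \<theta> - pi / 2 * e"
    using Im by (simp add: form_Log_def X_def p_def q_def)
  then show ?thesis
    by (simp add: \<theta>_def s_def e_def Q sgn_if)
qed

text \<open>The two roots differ, so the quotient is not real; in particular it avoids the branch
  cut, off which \<open>Ln\<close> commutes with conjugation.\<close>

lemma form_Log_cnj:
  assumes "Q \<in> forms D" "Im z > 0"
  shows "form_Log Q (cnj z) = cnj (form_Log Q z)"
proof -
  obtain a b c where Q: "Q = (a, b, c)"
    by (cases Q)
  define p q where "p = root_plus Q" and "q = root_minus Q"
  have "p \<noteq> q"
    using root_diff[of a b c] sqrt_D_pos form_coeff_nonzero[of a b c] assms(1) Q
    unfolding p_def q_def by auto
  have zp: "z - of_real p \<noteq> 0"
    using assms(2) by auto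
  have "(z - of_real q) / (z - of_real p) \<notin> \<real>"
  proof
    assume "(z - of_real q) / (z - of_real p) \<in> \<real>"
    then obtain u where "(z - of_real q) / (z - of_real p) = of_real u"
      by (auto simp: Reals_def)
    then have "z - of_real q = of_real u * (z - of_real p)"
      using zp by (simp add: field_simps)
    then have "Im z = u * Im z" "Re z - q = u * (Re z - p)"
      by (auto simp: complex_eq_iff)
    with assms(2) \<open>p \<noteq> q\<close> show False
      by auto
  qed
  then have "(z - of_real q) / (z - of_real p) \<notin> \<real>\<^sub>\<le>\<^sub>0"
    using nonpos_Reals_subset_Reals by blast
  then show ?thesis
    by (simp add: form_Log_def p_def q_def cnj_Ln)
qed

lemma form_at_cnj: "form_at Q (cnj z) = - form_at Q z"
  by (cases Q) simp

section \<open>Identity with \<open>Omega\<close>\<close>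

text \<open>Each logarithm is its conjugate plus 2 i times its imaginary part. The conjugate is the
  logarithm at \<open>cnj z\<close> and yields \<open>rho\<close>; the imaginary part yields
  \<open>phi\<close> and \<open>lambda\<close>, with \<open>form_at\<close> changing sign under
  conjugation. The three series converge separately, so the sum may be split.\<close>

lemma omega_eq_Omega:
  assumes "n \<ge> 3" "Im t > 0" "Im z > 0"
  shows "omega n D t z = Omega n D t (cnj z)"
proof -
  let ?E = "\<lambda>Q. form_eval Q t 1 ^ n"
  let ?A = "\<lambda>Q. complex_of_real (arctan (form_at Q (cnj z) / sqrt (of_int D)))"
  have S1: "(\<lambda>Q. form_Log Q (cnj z) / ?E Q) summable_on forms D"
    using norm_form_Log_le form_Log_cnj assms
    by (intro summable_form_series[where B = "sqrt (of_int D) / Im z"]) auto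
  have S2: "(\<lambda>Q. of_int (form_sgn Q) / ?E Q) summable_on forms D"
    by (intro summable_form_series[where B = 1] assms) (auto simp: sgn_if)
  have "norm (?A Q) \<le> pi / 2" for Q
    using arctan_bounded[of "form_at Q (cnj z) / sqrt (of_int D)"] by (simp only: norm_of_real) linarith
  then have S3: "(\<lambda>Q. ?A Q / ?E Q) summable_on forms D"
    by (intro summable_form_series[where B = "pi / 2"] assms)
  have "form_Log Q z / ?E Q = form_Log Q (cnj z) / ?E Q +
      (- (of_real pi * \<i>) * (of_int (form_sgn Q) / ?E Q) + - (2 * \<i>) * (?A Q / ?E Q))"
    if "Q \<in> forms D" for Q
  proof -
    have "form_Log Q z = cnj (form_Log Q z) + 2 * \<i> * of_real (Im (form_Log Q z))"
      by (simp add: complex_eq_iff)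
    also have "\<dots> = form_Log Q (cnj z) + (- (of_real pi * \<i>) * of_int (form_sgn Q) + - (2 * \<i>) * ?A Q)"
      using that assms(3)
      by (simp add: Im_form_Log form_Log_cnj form_at_cnj arctan_minus algebra_simps)
    finally show ?thesis
      by (simp add: add_divide_distrib diff_divide_distrib)
  qed
  then have "(\<Sum>\<^sub>\<infinity>Q\<in>forms D. form_Log Q z / ?E Q) =
      (\<Sum>\<^sub>\<infinity>Q\<in>forms D. form_Log Q (cnj z) / ?E Q +
      (- (of_real pi * \<i>) * (of_int (form_sgn Q) / ?E Q) + - (2 * \<i>) * (?A Q / ?E Q)))"
    by (rule infsum_cong)
  also have "\<dots> = (\<Sum>\<^sub>\<infinity>Q\<in>forms D. form_Log Q (cnj z) / ?E Q) +
      (- (of_real pi * \<i>) * (\<Sum>\<^sub>\<infinity>Q\<in>forms D. of_int (form_sgn Q) / ?E Q) +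
       - (2 * \<i>) * (\<Sum>\<^sub>\<infinity>Q\<in>forms D. ?A Q / ?E Q))"
    using S1 S2 S3
    by (simp only: infsum_add summable_on_add summable_on_cmult_right infsum_cmult_right)
  finally show ?thesis
    by (simp add: omega_def Omega_def rho_def phi_def lambda_def)
qed

section \<open>Modular transformations\<close>

text \<open>The form Q(x + m y, y).\<close>

fun form_shift :: "int \<Rightarrow> bqf \<Rightarrow> bqf" where
  "form_shift m (a, b, c) = (a, 2 * a * m + b, a * m\<^sup>2 + b * m + c)"

text \<open>The form Q(-y, x).\<close>

fun form_invert :: "bqf \<Rightarrow> bqf" where
  "form_invert (a, b, c) = (c, - b, a)"

lemma form_shift_in_forms: "Q \<in> forms D \<Longrightarrow> form_shift m Q \<in> forms D"
  by (cases Q) (auto simp: forms_def algebra_simps power2_eq_square)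

lemma form_invert_in_forms: "Q \<in> forms D \<Longrightarrow> form_invert Q \<in> forms D"
  by (cases Q) (auto simp: forms_def algebra_simps)

lemma bij_betw_form_shift: "bij_betw (form_shift m) (forms D) (forms D)"
proof (rule bij_betw_byWitness[where f' = "form_shift (- m)"])
  show "\<forall>Q\<in>forms D. form_shift (- m) (form_shift m Q) = Q"
    "\<forall>Q\<in>forms D. form_shift m (form_shift (- m) Q) = Q"
    by (auto simp: algebra_simps power2_eq_square)
qed (blast intro: form_shift_in_forms)+

lemma bij_betw_form_invert: "bij_betw form_invert (forms D) (forms D)"
proof (rule bij_betw_byWitness[where f' = form_invert])
qed (use form_invert_in_forms in auto)

lemma form_eval_shift: "form_eval (form_shift m Q) t 1 = form_eval Q (t + of_int m) 1"
  by (cases Q) (simp add: form_eval.simps algebra_simps power2_eq_square)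

lemma form_eval_invert:
  assumes "t \<noteq> 0"
  shows "form_eval (form_invert Q) t 1 = t\<^sup>2 * form_eval Q (- 1 / t) 1"
  using assms by (cases Q) (simp add: form_eval.simps field_simps power2_eq_square)

text \<open>Both roots move by -m and a is unchanged, so the roots keep their roles.\<close>

lemma form_Log_shift:
  assumes "Q \<in> forms D"
  shows "form_Log (form_shift m Q) z = form_Log Q (z + of_int m)"
proof -
  obtain a b c where Q: "Q = (a, b, c)"
    by (cases Q)
  have a: "of_int a \<noteq> (0::real)"
    using form_coeff_nonzero[of a b c] assms Q by simp
  have "root_plus (form_shift m Q) = root_plus Q - of_int m"
    "root_minus (form_shift m Q) = root_minus Q - of_int m"
    unfolding root_plus_eq[OF form_shift_in_forms[OF assms]] root_plus_eq[OF assms]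
      root_minus_eq[OF form_shift_in_forms[OF assms]] root_minus_eq[OF assms]
    using a by (simp_all add: Q field_simps)
  then show ?thesis
    by (simp add: form_Log_def diff_diff_eq2)
qed

text \<open>
  Inversion can move the logarithm by a constant, so only differences transform well: both sides
  have the same derivative.
\<close>

lemma form_Log_diff_invert:
  assumes "Q \<in> forms D" "Im t > 0" "Im z > 0"
  shows "form_Log Q (- 1 / t) - form_Log Q (- 1 / z) =
    form_Log (form_invert Q) t - form_Log (form_invert Q) z"
proof -
  let ?H = "{w. Im w > 0}"
  have "\<exists>C. \<forall>w\<in>?H. form_Log Q (- 1 / w) - form_Log (form_invert Q) w = C"
  proof (rule has_field_derivative_zero_constant)
    show "convex ?H"
      by (rule convex_halfspace_Im_gt)
    fix w assume "w \<in> ?H"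
    then have w: "Im w > 0" "w \<noteq> 0"
      by auto
    have Iw: "Im (- 1 / w) > 0"
      using w by (simp add: Im_divide zero_less_divide_iff sum_power2_gt_zero_iff complex_eq_iff)
    \<comment> \<open>The chain-rule factor 1 / w^2 is exactly what turns Q(-1/w, 1) into the
      inverted form at w.\<close>
    have eq: "- of_real (sqrt (of_int D)) / form_eval Q (- 1 / w) 1 * (1 / w\<^sup>2) =
        - of_real (sqrt (of_int D)) / form_eval (form_invert Q) w 1"
      unfolding form_eval_invert[OF w(2)] by simp
    have "((\<lambda>w. - 1 / w) has_field_derivative 1 / w\<^sup>2) (at w)"
      using w(2) by (auto intro!: derivative_eq_intros simp: power2_eq_square)
    from DERIV_chain2[OF form_Log_deriv[OF assms(1) Iw] this]
    have "((\<lambda>w. form_Log Q (- 1 / w)) has_field_derivative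
        - of_real (sqrt (of_int D)) / form_eval (form_invert Q) w 1) (at w)"
      unfolding eq .
    from DERIV_diff[OF this form_Log_deriv[OF form_invert_in_forms[OF assms(1)] w(1)]]
    show "((\<lambda>w. form_Log Q (- 1 / w) - form_Log (form_invert Q) w) has_field_derivative 0)
        (at w within ?H)"
      unfolding diff_self by (rule has_field_derivative_at_within)
  qed
  then obtain C where "form_Log Q (- 1 / w) - form_Log (form_invert Q) w = C" if "Im w > 0" for w
    by auto
  then have "form_Log Q (- 1 / t) - form_Log (form_invert Q) t =
      form_Log Q (- 1 / z) - form_Log (form_invert Q) z"
    using assms(2,3) by simp
  moreover have "x - x' = y - y'" if "x - y = x' - y'" for x x' y y' :: complex
    using that by (simp add: algebra_simps)
  ultimately show ?thesis
    by blast
qed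

text \<open>Combines the two convergent series into one whose numerators are differences of
  logarithms, the shape that behaves well under inversion.\<close>

lemma omega_eq_infsum:
  assumes "n \<ge> 3" "Im t > 0" "Im z > 0"
  shows "omega n D t z = (\<Sum>\<^sub>\<infinity>Q\<in>forms D. (form_Log Q t - form_Log Q z) / form_eval Q t 1 ^ n)"
proof -
  have S: "(\<lambda>Q. form_Log Q w / form_eval Q t 1 ^ n) summable_on forms D" if "Im w > 0" for w
    using norm_form_Log_le that
    by (intro summable_form_series[where B = "sqrt (of_int D) / Im w"] assms) auto
  let ?F = "\<lambda>w Q. form_Log Q w / form_eval Q t 1 ^ n"
  have "(\<Sum>\<^sub>\<infinity>Q\<in>forms D. ?F t Q + - 1 * ?F z Q) =
      infsum (?F t) (forms D) + - 1 * infsum (?F z) (forms D)"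
    using S assms(2,3) by (simp only: infsum_add summable_on_cmult_right infsum_cmult_right)
  then show ?thesis
    by (simp add: omega_def psi_def diff_divide_distrib)
qed

text \<open>Translation respects each single logarithm, so both series are reindexed separately by
  the bijection \<open>form_shift m\<close>.\<close>

lemma omega_shift: "omega n D (t + of_int m) (z + of_int m) = omega n D t z"
proof -
  have "(\<Sum>\<^sub>\<infinity>Q\<in>forms D. form_Log Q (w + of_int m) / form_eval Q (t + of_int m) 1 ^ n) =
      (\<Sum>\<^sub>\<infinity>Q\<in>forms D. form_Log Q w / form_eval Q t 1 ^ n)" for w
  proof -
    have "(\<Sum>\<^sub>\<infinity>Q\<in>forms D. form_Log Q (w + of_int m) / form_eval Q (t + of_int m) 1 ^ n) =
      (\<Sum>\<^sub>\<infinity>Q\<in>forms D. form_Log (form_shift m Q) w / form_eval (form_shift m Q) t 1 ^ n)"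
      by (intro infsum_cong) (simp add: form_Log_shift form_eval_shift)
    also have "\<dots> = (\<Sum>\<^sub>\<infinity>Q\<in>forms D. form_Log Q w / form_eval Q t 1 ^ n)"
      by (rule infsum_reindex_bij_betw[OF bij_betw_form_shift])
    finally show ?thesis .
  qed
  then show ?thesis
    by (simp add: omega_def psi_def)
qed

text \<open>The automorphy factor is the n-th power of the t^2 in \<open>form_eval_invert\<close>;
  the numerators only get reindexed by \<open>form_invert\<close>.\<close>

lemma omega_invert:
  assumes "n \<ge> 3" "Im t > 0" "Im z > 0"
  shows "omega n D (- 1 / t) (- 1 / z) = t ^ (2 * n) * omega n D t z"
proof -
  let ?I = form_invert
  have im: "Im (- 1 / w) > 0" if "Im w > 0" for w
    using that by (simp add: Im_divide zero_less_divide_iff sum_power2_gt_zero_iff complex_eq_iff)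
  have t: "t \<noteq> 0"
    using assms(2) by auto
  have E: "1 / form_eval Q (- 1 / t) 1 ^ n = t ^ (2 * n) * (1 / form_eval (?I Q) t 1 ^ n)" for Q
    unfolding form_eval_invert[OF t] using t
    by (simp add: power_mult_distrib power_mult)
  have "omega n D (- 1 / t) (- 1 / z) =
    (\<Sum>\<^sub>\<infinity>Q\<in>forms D. (form_Log Q (- 1 / t) - form_Log Q (- 1 / z)) * (1 / form_eval Q (- 1 / t) 1 ^ n))"
    using omega_eq_infsum[OF assms(1) im im] assms(2,3) by simp
  also have "\<dots> = (\<Sum>\<^sub>\<infinity>Q\<in>forms D. t ^ (2 * n) *
      ((form_Log (?I Q) t - form_Log (?I Q) z) / form_eval (?I Q) t 1 ^ n))"
    unfolding E by (intro infsum_cong) (simp only: form_Log_diff_invert[OF _ assms(2,3)] times_divide_eq_right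
        mult_1_right mult_1_left mult.left_commute mult.commute)
  also have "\<dots> = t ^ (2 * n) *
      (\<Sum>\<^sub>\<infinity>Q\<in>forms D. (form_Log (?I Q) t - form_Log (?I Q) z) / form_eval (?I Q) t 1 ^ n)"
    by (rule infsum_cmult_right')
  also have "\<dots> = t ^ (2 * n) * omega n D t z"
    unfolding omega_eq_infsum[OF assms]
    by (subst infsum_reindex_bij_betw[OF bij_betw_form_invert]) (rule refl)
  finally show ?thesis .
qed

section \<open>Limits at i infinity\<close>

lemma abs_series_shift: "abs_series n (t + of_int m) = abs_series n t"
  unfolding abs_series_def form_eval_shift[symmetric]
  by (rule infsum_reindex_bij_betw[OF bij_betw_form_shift])

lemma abs_series_le:
  assumes "n \<ge> 3" "Im t \<ge> 1"
  shows "abs_series n t \<le> (4 / Im t) ^ n * (\<Sum>\<^sub>\<infinity>Q\<in>forms D. 1 / form_size Q ^ n)"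
proof -
  \<comment> \<open>The bound on \<^const>\<open>form_size\<close> is not uniform in \<open>Re t\<close>; periodicity makes it so.\<close>
  define t' where "t' = t + of_int (- \<lfloor>Re t\<rfloor>)"
  have t': "Im t' = Im t" "\<bar>Re t'\<bar> \<le> 1"
    unfolding t'_def by simp_all linarith
  define y where "y = Im t"
  have y: "y \<ge> 1"
    using assms by (simp add: y_def)
  \<comment> \<open>The constant of \<open>form_size_le\<close> with \<open>X\<close> = 1; for y >=
    1 it is dominated by its 1/y part.\<close>
  have "1 / y + (1 + 2 * 1) / y\<^sup>2 \<le> 4 / y"
    using y by (simp add: field_simps power2_eq_square)
  then have C: "(1 / y + (1 + 2 * 1) / y\<^sup>2) ^ n \<le> (4 / y) ^ n"
    using y by (intro power_mono) auto
  have "abs_series n t = abs_series n t'"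
    unfolding t'_def by (rule abs_series_shift[symmetric])
  also have "\<dots> \<le> (\<Sum>\<^sub>\<infinity>Q\<in>forms D. (4 / y) ^ n * (1 / form_size Q ^ n))"
    unfolding abs_series_def
  proof (rule infsum_mono)
    show "(\<lambda>Q. 1 / norm (form_eval Q t' 1) ^ n) summable_on forms D"
      using assms t' by (intro summable_abs_series) auto
    show "(\<lambda>Q. (4 / y) ^ n * (1 / form_size Q ^ n)) summable_on forms D"
      using summable_form_size[OF assms(1)] by (rule summable_on_cmult_right)
    fix Q assume Q: "Q \<in> forms D"
    have "1 / norm (form_eval Q t' 1) ^ n \<le> (1 / y + (1 + 2 * 1) / y\<^sup>2) ^ n * (1 / form_size Q ^ n)"
      using Q t' y by (intro form_eval_power_bound) (auto simp: y_def)
    also have "\<dots> \<le> (4 / y) ^ n * (1 / form_size Q ^ n)"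
      using C form_size_ge_1[OF Q] by (intro mult_right_mono) auto
    finally show "1 / norm (form_eval Q t' 1) ^ n \<le> (4 / y) ^ n * (1 / form_size Q ^ n)" .
  qed
  also have "\<dots> = (4 / Im t) ^ n * (\<Sum>\<^sub>\<infinity>Q\<in>forms D. 1 / form_size Q ^ n)"
    unfolding y_def by (rule infsum_cmult_right')
  finally show ?thesis .
qed

lemma norm_form_Log_series_le:
  assumes "n \<ge> 3" "Im t > 0" "Im z > 0"
  shows "norm (\<Sum>\<^sub>\<infinity>Q\<in>forms D. form_Log Q z / form_eval Q t 1 ^ n) \<le>
    sqrt (of_int D) / Im z * abs_series n t"
  using assms norm_form_Log_le by (intro norm_form_series_le) auto

text \<open>The filter \<open>Im going_to at_top\<close> lets the imaginary part tend to infinity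
  with no constraint on the real part.\<close>

lemma tendsto_Im_going_to: "((\<lambda>z. c / Im z) \<longlongrightarrow> 0) (Im going_to at_top)"
  by (rule real_tendsto_divide_at_top[OF tendsto_const filterlim_going_toI_weak])

text \<open>Only the subtracted series depends on z, and its logarithms are bounded by
  \<open>sqrt D\<close> / \<open>Im z\<close> uniformly in the form.\<close>

lemma omega_tendsto_psi:
  assumes "n \<ge> 3" "Im t > 0"
  shows "((\<lambda>z. omega n D t z) \<longlongrightarrow> psi n D t) (Im going_to at_top)"
proof -
  have "((\<lambda>z. \<Sum>\<^sub>\<infinity>Q\<in>forms D. form_Log Q z / form_eval Q t 1 ^ n) \<longlongrightarrow> 0) (Im going_to at_top)"
  proof (rule Lim_null_comparison)
    show "\<forall>\<^sub>F z in Im going_to at_top. norm (\<Sum>\<^sub>\<infinity>Q\<in>forms D. form_Log Q z / form_eval Q t 1 ^ n) \<le>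
        sqrt (of_int D) / Im z * abs_series n t"
      using eventually_going_toI[OF eventually_gt_at_top[of "0::real"], of Im]
      by eventually_elim (rule norm_form_Log_series_le[OF assms])
    show "((\<lambda>z. sqrt (of_int D) / Im z * abs_series n t) \<longlongrightarrow> 0) (Im going_to at_top)"
      by (rule tendsto_mult_left_zero[OF tendsto_Im_going_to])
  qed
  from tendsto_diff[OF tendsto_const this, of "psi n D t"] show ?thesis
    by (simp add: omega_def)
qed

text \<open>The logarithms stay bounded as \<open>Im t\<close> grows, while the majorant decays like
  the n-th power of 4 / \<open>Im t\<close>.\<close>

lemma omega_tendsto_0:
  assumes "n \<ge> 3" "Im z > 0"
  shows "((\<lambda>t. omega n D t z) \<longlongrightarrow> 0) (Im going_to at_top)"
proof (rule Lim_null_comparison)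
  let ?K = "\<Sum>\<^sub>\<infinity>Q\<in>forms D. 1 / form_size Q ^ n"
  let ?d = "sqrt (of_int D)"
  show "\<forall>\<^sub>F t in Im going_to at_top. norm (omega n D t z) \<le>
      (?d / Im t + ?d / Im z) * ((4 / Im t) ^ n * ?K)"
    using eventually_going_toI[OF eventually_ge_at_top[of "1::real"], of Im]
  proof eventually_elim
    case (elim t)
    have "norm (omega n D t z) \<le> ?d / Im t * abs_series n t + ?d / Im z * abs_series n t"
      unfolding omega_def psi_def using norm_form_Log_series_le assms elim
      by (intro norm_triangle_le_diff add_mono) auto
    also have "\<dots> = (?d / Im t + ?d / Im z) * abs_series n t"
      by (simp add: distrib_right)
    also have "\<dots> \<le> (?d / Im t + ?d / Im z) * ((4 / Im t) ^ n * ?K)"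
      using abs_series_le[OF assms(1) elim] assms elim sqrt_D_pos by (intro mult_left_mono) auto
    finally show ?case .
  qed
  have "((\<lambda>t. (4 / Im t) ^ n) \<longlongrightarrow> 0 ^ n) (Im going_to at_top)"
    by (intro tendsto_power tendsto_Im_going_to)
  then have "((\<lambda>t. (4 / Im t) ^ n) \<longlongrightarrow> 0) (Im going_to at_top)"
    using assms(1) by (simp add: power_0_left)
  from tendsto_mult[OF tendsto_add[OF tendsto_Im_going_to[of ?d] tendsto_const[of "?d / Im z"]]
      tendsto_mult[OF this tendsto_const[of ?K]]]
  show "((\<lambda>t. (?d / Im t + ?d / Im z) * ((4 / Im t) ^ n * ?K)) \<longlongrightarrow> 0) (Im going_to at_top)"
    by (simp only: mult_zero_left mult_zero_right)
qed

section \<open>Holomorphy in each variable\<close>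

lemma open_upper_half_plane: "open upper_half_plane"
  unfolding upper_half_plane_def by (rule open_halfspace_Im_gt)

text \<open>Taking \<open>g\<close> and \<open>h\<close> to be the identity or a constant covers
  \<open>psi\<close> and the subtracted series in either variable.\<close>

lemma form_Log_series_holomorphic:
  assumes n: "n \<ge> 3"
    and g: "g holomorphic_on upper_half_plane" "g ` upper_half_plane \<subseteq> upper_half_plane"
    and h: "h holomorphic_on upper_half_plane" "h ` upper_half_plane \<subseteq> upper_half_plane"
  shows "(\<lambda>w. \<Sum>\<^sub>\<infinity>Q\<in>forms D. form_Log Q (g w) / form_eval Q (h w) 1 ^ n)
    holomorphic_on upper_half_plane"
proof (rule holomorphic_on_infsum[OF open_upper_half_plane])
  fix Q assume Q: "Q \<in> forms D"
  obtain a b c where [simp]: "Q = (a, b, c)"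
    by (cases Q)
  have "(\<lambda>w. form_Log Q (g w)) holomorphic_on upper_half_plane"
    using holomorphic_on_compose_gen[OF g(1) form_Log_holomorphic[OF Q] g(2)] by (simp add: o_def)
  moreover have "(\<lambda>w. form_eval Q (h w) 1) holomorphic_on upper_half_plane"
    using h(1) by (auto simp: form_eval.simps intro!: holomorphic_intros)
  moreover have "form_eval Q (h w) 1 \<noteq> 0" if "w \<in> upper_half_plane" for w
    using norm_form_eval_pos[OF Q, of "h w"] h(2) that by (auto simp: upper_half_plane_def)
  ultimately show "(\<lambda>w. form_Log Q (g w) / form_eval Q (h w) 1 ^ n) holomorphic_on upper_half_plane"
    by (intro holomorphic_on_divide holomorphic_on_power) auto
next
  fix z assume "z \<in> upper_half_plane"
  then obtain r where r: "r > 0" and sub: "cball z r \<subseteq> upper_half_plane"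
    using open_contains_cball open_upper_half_plane by metis
  \<comment> \<open>On the compact disc the imaginary part attains its minimum, which is positive
    because \<open>f\<close> maps into the upper half-plane.\<close>
  have lower: "\<exists>y>0. \<forall>w\<in>cball z r. y \<le> Im (f w)"
    if "f holomorphic_on upper_half_plane" "f ` upper_half_plane \<subseteq> upper_half_plane" for f
  proof -
    have "continuous_on (cball z r) (\<lambda>w. Im (f w))"
      using that(1) sub
      by (intro continuous_intros holomorphic_on_imp_continuous_on holomorphic_on_subset[OF that(1)])
    then obtain w where "w \<in> cball z r" "\<forall>v\<in>cball z r. Im (f w) \<le> Im (f v)"
      using r continuous_attains_inf[of "cball z r" "\<lambda>w. Im (f w)"] by auto
    moreover from this have "Im (f w) > 0"
      using that(2) sub unfolding upper_half_plane_def by blast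
    ultimately show ?thesis
      by blast
  qed
  obtain y where y: "y > 0" "\<And>w. w \<in> cball z r \<Longrightarrow> y \<le> Im (g w)"
    using lower[OF g] by blast
  obtain y' where y': "y' > 0" "\<And>w. w \<in> cball z r \<Longrightarrow> y' \<le> Im (h w)"
    using lower[OF h] by blast
  have "compact ((\<lambda>w. Re (h w)) ` cball z r)"
    using holomorphic_on_imp_continuous_on[OF holomorphic_on_subset[OF h(1) sub]]
    by (intro compact_continuous_image continuous_intros) auto
  then obtain X where X: "\<And>w. w \<in> cball z r \<Longrightarrow> \<bar>Re (h w)\<bar> \<le> X"
    by (metis (no_types, lifting) bounded_iff compact_imp_bounded imageI real_norm_def)
  \<comment> \<open>The logarithm bound with \<open>Im (g w)\<close> >= \<open>y\<close>, times the
    bound for the forms in the region where \<open>Im (h w)\<close> >= \<open>y'\<close> and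
    |\<open>Re (h w)\<close>| <= \<open>X\<close>.\<close>
  let ?M = "\<lambda>Q. sqrt (of_int D) / y * ((1 / y' + (1 + 2 * X) / y'\<^sup>2) ^ n * (1 / form_size Q ^ n))"
  have "norm (form_Log Q (g w) / form_eval Q (h w) 1 ^ n) \<le> ?M Q"
    if Q: "Q \<in> forms D" and w: "w \<in> cball z r" for Q w
  proof -
    have "norm (form_Log Q (g w)) \<le> sqrt (of_int D) / Im (g w)"
      using y w by (intro norm_form_Log_le[OF Q]) force
    also have "\<dots> \<le> sqrt (of_int D) / y"
      using y w sqrt_D_pos by (intro divide_left_mono) (auto intro!: mult_pos_pos dest: order_less_le_trans)
    finally have "norm (form_Log Q (g w)) * (1 / norm (form_eval Q (h w) 1) ^ n) \<le> ?M Q"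
      using form_eval_power_bound[OF Q y'(2)[OF w] y'(1) X[OF w], of n] y sqrt_D_pos
      by (intro mult_mono) auto
    then show ?thesis
      by (simp add: norm_divide norm_power)
  qed
  moreover have "?M summable_on forms D"
    using summable_form_size[OF n] by (intro summable_on_cmult_right)
  ultimately show "\<exists>r>0. \<exists>M. M summable_on forms D \<and> cball z r \<subseteq> upper_half_plane \<and>
      (\<forall>Q\<in>forms D. \<forall>w\<in>cball z r. norm (form_Log Q (g w) / form_eval Q (h w) 1 ^ n) \<le> M Q)"
    using r sub by blast
qed

lemma omega_holomorphic_left:
  assumes "n \<ge> 3" "z \<in> upper_half_plane"
  shows "(\<lambda>t. omega n D t z) holomorphic_on upper_half_plane"
  unfolding omega_def psi_def using assms
  by (intro holomorphic_on_diff form_Log_series_holomorphic holomorphic_intros) auto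

lemma omega_holomorphic_right:
  assumes "n \<ge> 3" "t \<in> upper_half_plane"
  shows "(\<lambda>z. omega n D t z) holomorphic_on upper_half_plane"
  unfolding omega_def using assms
  by (intro holomorphic_on_diff form_Log_series_holomorphic holomorphic_intros) auto

end

theorem corollary1p2:
  fixes D :: int and k :: nat and \<tau> z :: complex
  assumes "D > 0" and "is_discriminant D" and "\<nexists>m. D = m\<^sup>2"
    and "k > 0" and "even k"
    and "\<tau> \<in> upper_half_plane" and "z \<in> upper_half_plane"
  shows "omega (k + 1) D \<tau> z = Omega (k + 1) D \<tau> (cnj z)
    \<and> omega (k + 1) D (\<tau> + 1) (z + 1) = omega (k + 1) D \<tau> z
    \<and> omega (k + 1) D (- 1 / \<tau>) (- 1 / z) = \<tau> ^ (2 * k + 2) * omega (k + 1) D \<tau> z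
    \<and> ((\<lambda>\<zeta>. omega (k + 1) D \<tau> \<zeta>) \<longlongrightarrow> psi (k + 1) D \<tau>) (Im going_to at_top)
    \<and> ((\<lambda>t. omega (k + 1) D t z) \<longlongrightarrow> 0) (Im going_to at_top)
    \<and> omega (k + 1) D \<tau> \<tau> = 0
    \<and> (\<lambda>t. omega (k + 1) D t z) holomorphic_on upper_half_plane
    \<and> (\<lambda>\<zeta>. omega (k + 1) D \<tau> \<zeta>) holomorphic_on upper_half_plane"
proof -
  interpret nonsquare_discriminant D
    using assms by unfold_locales
  \<comment> \<open>An even positive k is at least 2, which gives the exponent 3 required for
    convergence.\<close>
  have n: "k + 1 \<ge> 3"
    using \<open>k > 0\<close> \<open>even k\<close> by presburger
  have t: "Im \<tau> > 0" and z: "Im z > 0"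
    using assms by (auto simp: upper_half_plane_def)
  have "omega (k + 1) D (\<tau> + 1) (z + 1) = omega (k + 1) D \<tau> z"
    using omega_shift[of "k + 1" \<tau> 1 z] by simp
  moreover have "omega (k + 1) D (- 1 / \<tau>) (- 1 / z) = \<tau> ^ (2 * k + 2) * omega (k + 1) D \<tau> z"
    using omega_invert[OF n t z] by simp
  moreover have "omega (k + 1) D \<tau> \<tau> = 0"
    by (simp add: omega_def psi_def)
  ultimately show ?thesis
    using omega_eq_Omega[OF n t z] omega_tendsto_psi[OF n t] omega_tendsto_0[OF n z]
      omega_holomorphic_left[OF n assms(7)] omega_holomorphic_right[OF n assms(6)]
    by (intro conjI)
qed

end
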